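(* Let $n,m\ge 1$, let $\mathcal G=(\mathcal V,\mathcal E)$ be an undirected graph with $\mathcal V=\{1,\dots,n\}$ and neighbor sets $\mathcal N_i=\{j : (i,j)\in\mathcal E\}$, let $f_i:\mathbb R^m\to\mathbb R$ and $\Omega_i\subset\mathbb R^m$ for $i\in\mathcal V$, and let $K\ge 0$. Assume: (1) for each $i\in\mathcal V$, $f_i$ is convex on an open (convex) set containing $\Omega_i$, $\Omega_i$ is convex and compact, and $\bigcap_{i=1}^n \mathrm{int}(\Omega_i)\neq\emptyset$; (2) there is a constant $c>0$ such that $|f_i(x)-f_i(y)|\le c\|x-y\|$ for all $x,y\in\Omega_i$ and all $i\in\mathcal V$; (3) $\mathcal G$ is connected; (4) there is a constant $\beta>0$ such that for each $i\in\mathcal V$, $\langle x-y,\,g-h\rangle\ge\beta\|x-y\|^2$ for all $x,y\in\Omega_i$, $g\in\partial f_i(x)$, $h\in\partial f_i(y)$. Let $\bar\Omega=\Omega_1\times\dots\times\Omega_n$ and, for $\bm x=(x_1,\dots,x_n)$, $$\mathcal L(\bm x)=\sum_{i=1}^n f_i(x_i)+\frac K2\sum_{i=1}^n\sum_{j\in\mathcal N_i}|x_i-x_j| .$$ Then the dynamics $$\dot{\bm x}(t)\in P_{\mathcal T_{\bar\Omega}(\bm x(t))}\big[-\partial\mathcal L(\bm x(t))\big],\qquad \bm x(0)=\bm x_0\in\bar\Omega,$$ converges exponentially to its (unique) equilibrium point $\bm x^*$; that is, there exist constants $M,\lambda>0$ such that every solution $\bm x(t)$ on $[0,\infty)$ satisfies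 $\|\bm x(t)-\bm x^*\|\le M\|\bm x(0)-\bm x^*\|e^{-\lambda t}$ for all $t\ge 0$.
   Context: $\|\cdot\|$ is the Euclidean norm and $|\cdot|$ applied to a vector is the $l_1$-norm. $\partial$ denotes the subdifferential of a convex function: $g\in\partial f(x)$ iff $f(y)\ge f(x)+\langle y-x,g\rangle$ for all $y$ in the (open convex) domain on which $f$ is convex. For a closed convex set $\Omega$ and $x\in\Omega$, the tangent cone is $\mathcal T_\Omega(x)=\{\lim_{k\to\infty}(x_k-x)/\tau_k : x_k\in\Omega,\ x_k\to x,\ \tau_k>0,\ \tau_k\to0\}$, and $P_{\mathcal T_\Omega(x)}(y)$ is the Euclidean projection of $y$ onto $\mathcal T_\Omega(x)$. For a set $S$, $P_{\mathcal T_\Omega(x)}[S]=\{P_{\mathcal T_\Omega(x)}(y): y\in S\}$. A (Caratheodory) solution of a differential inclusion $\dot x\in\mathcal F(x)$ is an absolutely continuous function (on compact intervals) satisfying the inclusion for almost every $t$. A point $x_e$ is an equilibrium point if $0\in\mathcal F(x_e)$. Written agent by agent, the dynamics reads $\dot x_i\in P_{\mathcal T_{\Omega_i}(x_i)}[-\partial f_i(x_i)-K\sum_{j\in\mathcal N_i}\mathrm{Sgn}(x_i-x_j)]$, where $\mathrm{Sgn}$ is the entrywise set-valued sign ($\{1\}$, $[-1,1]$, $\{-1\}$ for positive, zero, negative entries), the selections for $(i,j)$ and $(j,i)$ being opposite, since together they form an element of $\partial\mathcal L(\bm x)$. *)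

theory Defs
  imports "HOL-Analysis.Analysis"
begin

text \<open>
  The subdifferential is taken relative to the domain \<open>D\<close> on which the function is convex;
  the values of \<open>f\<close> outside \<open>D\<close> play no role.
\<close>

definition subdifferential :: "'a::real_inner set \<Rightarrow> ('a \<Rightarrow> real) \<Rightarrow> 'a \<Rightarrow> 'a set" where
  "subdifferential D f x = {g. \<forall>y\<in>D. f y \<ge> f x + (y - x) \<bullet> g}"

definition tangent_cone :: "'a::real_normed_vector set \<Rightarrow> 'a \<Rightarrow> 'a set" where
  "tangent_cone \<Omega> x =
     {v. \<exists>(s :: nat \<Rightarrow> 'a) (\<tau> :: nat \<Rightarrow> real).
           (\<forall>k. s k \<in> \<Omega>) \<and> s \<longlonglongrightarrow> x \<and> (\<forall>k. \<tau> k > 0) \<and> \<tau> \<longlonglongrightarrow> 0 \<and>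
           (\<lambda>k. (s k - x) /\<^sub>R \<tau> k) \<longlonglongrightarrow> v}"

text \<open>
  The right-hand side of the projected subgradient inclusion. It is a map on \<open>\<Omega>\<close>, encoded as a
  total function by assigning the empty set to points outside \<open>\<Omega>\<close>; hence solutions and
  equilibria are confined to \<open>\<Omega>\<close>.
\<close>

definition projected_subgradient ::
    "'a::euclidean_space set \<Rightarrow> 'a set \<Rightarrow> ('a \<Rightarrow> real) \<Rightarrow> 'a \<Rightarrow> 'a set" where
  "projected_subgradient \<Omega> D f x =
     (if x \<in> \<Omega>
      then closest_point (tangent_cone \<Omega> x) ` uminus ` subdifferential D f x
      else {})"

text \<open>A finite set of pairs \<open>(u, v)\<close> stands for a finite family of non-overlapping intervals.\<close>

definition abs_continuous_on :: "real \<Rightarrow> real \<Rightarrow> (real \<Rightarrow> 'a::real_normed_vector) \<Rightarrow> bool" where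
  "abs_continuous_on a b x \<longleftrightarrow>
     (\<forall>\<epsilon>>0. \<exists>\<delta>>0. \<forall>P :: (real \<times> real) set.
        finite P \<and> (\<forall>(u, v)\<in>P. a \<le> u \<and> u \<le> v \<and> v \<le> b) \<and>
        pairwise (\<lambda>p q. {fst p<..<snd p} \<inter> {fst q<..<snd q} = {}) P \<and>
        (\<Sum>(u, v)\<in>P. v - u) < \<delta>
        \<longrightarrow> (\<Sum>(u, v)\<in>P. norm (x v - x u)) < \<epsilon>)"

definition caratheodory_solution ::
    "('a::euclidean_space \<Rightarrow> 'a set) \<Rightarrow> (real \<Rightarrow> 'a) \<Rightarrow> bool" where
  "caratheodory_solution F x \<longleftrightarrow>
     (\<forall>a b. 0 \<le> a \<and> a \<le> b \<longrightarrow> abs_continuous_on a b x) \<and>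
     (AE t in lebesgue. t \<ge> 0 \<longrightarrow>
        (\<exists>v\<in>F (x t). (x has_vector_derivative v) (at t within {0..})))"

definition equilibrium_point :: "('a::zero \<Rightarrow> 'a set) \<Rightarrow> 'a \<Rightarrow> bool" where
  "equilibrium_point F x \<longleftrightarrow> 0 \<in> F x"

definition l1_norm :: "real ^ 'm \<Rightarrow> real" where
  "l1_norm v = (\<Sum>k\<in>UNIV. \<bar>v $ k\<bar>)"

definition undirected_graph :: "'n rel \<Rightarrow> bool" where
  "undirected_graph E \<longleftrightarrow> sym E"

definition neighbors :: "'n rel \<Rightarrow> 'n \<Rightarrow> 'n set" where
  "neighbors E i = {j. (i, j) \<in> E}"

definition connected_graph :: "'n rel \<Rightarrow> bool" where
  "connected_graph E \<longleftrightarrow> (\<forall>i j. (i, j) \<in> E\<^sup>*)"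

text \<open>
  A point of \<open>real ^ 'm ^ 'n\<close> collects the states of all agents; the library norm on this type
  is the Euclidean norm of the stacked vector.
\<close>

definition product_set :: "('n \<Rightarrow> (real ^ 'm) set) \<Rightarrow> (real ^ 'm ^ 'n) set" where
  "product_set S = {x. \<forall>i. x $ i \<in> S i}"

definition penalized_objective ::
    "'n::finite rel \<Rightarrow> ('n \<Rightarrow> real ^ 'm \<Rightarrow> real) \<Rightarrow> real \<Rightarrow> real ^ 'm ^ 'n \<Rightarrow> real" where
  "penalized_objective E f K x =
     (\<Sum>i\<in>UNIV. f i (x $ i)) +
     K / 2 * (\<Sum>i\<in>UNIV. \<Sum>j\<in>neighbors E i. l1_norm (x $ i - x $ j))"

definition penalty_dynamics ::
    "'n::finite rel \<Rightarrow> ('n \<Rightarrow> real ^ 'm \<Rightarrow> real) \<Rightarrow> ('n \<Rightarrow> (real ^ 'm) set) \<Rightarrow>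
     ('n \<Rightarrow> (real ^ 'm) set) \<Rightarrow> real \<Rightarrow> real ^ 'm::finite ^ 'n \<Rightarrow> (real ^ 'm ^ 'n) set" where
  "penalty_dynamics E f \<Omega> U K =
     projected_subgradient (product_set \<Omega>) (product_set U) (penalized_objective E f K)"

end

theory Submission
  imports Defs
begin

text \<open>
  The penalized objective is strongly convex on the product of the constraint sets, so it has a
  single minimizer there, and the squared distance to this minimizer is a strict Lyapunov function.

  \<^bold>\<open>Strong convexity.\<close> Strong monotonicity of the subdifferentials of the local objectives yields,
  using subgradients at the midpoint \<open>m\<close> of \<open>x\<close> and \<open>y\<close> and at the midpoints of the two halves,
  \<open>2 f(m) + \<gamma> \<parallel>x - y\<parallel>\<^sup>2 \<le> f(x) + f(y)\<close> with \<open>\<gamma> = \<beta>/8\<close>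
  (\<open>strongly_monotone_imp_midpoint_strongly_convex\<close>). This midpoint inequality is
  stable under sums over the agents and under adding the convex penalty. It returns
  directly a strengthened subgradient inequality for the whole objective, so a subgradient of the
  sum never has to be split into subgradients of the summands.

  \<^bold>\<open>Equilibrium.\<close> A minimizer of a convex function over a convex set carries a subgradient whose
  negative is normal to the set; this is obtained by separating the epigraph from the points below
  the minimal value (\<open>constrained_minimum_subgradient\<close>). Projecting a normal vector to the tangent
  cone gives zero, hence the minimizer is an equilibrium.

  \<^bold>\<open>Dissipation.\<close> The tangent cone of a convex set is a closed convex cone, so projecting \<open>-g\<close> to it
  can only increase the component towards any other point of the set
  (\<open>projected_subgradient_dissipation\<close>). With the strengthened subgradient inequality this gives
  \<open>(x - x\<^sup>*) \<bullet> v \<le> -\<gamma> \<parallel>x - x\<^sup>*\<parallel>\<^sup>2\<close> for each admissible velocity \<open>v\<close> at \<open>x\<close>.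
  Taking \<open>v = 0\<close> shows that the equilibrium is unique.

  \<^bold>\<open>Decay.\<close> Along a solution \<open>exp(2 \<gamma> t) \<parallel>x(t) - x\<^sup>*\<parallel>\<^sup>2\<close> is absolutely continuous with
  nonpositive derivative almost everywhere, hence nonincreasing
  (\<open>abs_continuous_on_imp_nonincreasing\<close>). So the bound holds with \<open>M = 1\<close> and rate \<open>\<gamma>\<close>.
\<close>

section \<open>Absolutely continuous functions and exponential decay\<close>

lemma sum_lengths_le_measure:
  fixes P :: "(real \<times> real) set"
  assumes "finite P"
    and le: "\<And>u v. (u, v) \<in> P \<Longrightarrow> u \<le> v"
    and sub: "\<And>u v. (u, v) \<in> P \<Longrightarrow> {u<..<v} \<subseteq> T"
    and disj: "pairwise (\<lambda>p q. {fst p<..<snd p} \<inter> {fst q<..<snd q} = {}) P"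
    and T: "T \<in> lmeasurable"
  shows "(\<Sum>(u, v)\<in>P. v - u) \<le> measure lebesgue T"
proof -
  have "(\<Sum>(u, v)\<in>P. v - u) = (\<Sum>p\<in>P. measure lebesgue {fst p<..<snd p})"
    using le by (intro sum.cong) auto
  also have "\<dots> = measure lebesgue (\<Union>p\<in>P. {fst p<..<snd p})"
  proof (rule measure_finite_Union[symmetric])
    show "finite P" by fact
    show "disjoint_family_on (\<lambda>p. {fst p<..<snd p}) P"
      using disj by (auto simp: disjoint_family_on_def pairwise_def)
    show "(\<lambda>p. {fst p<..<snd p}) ` P \<subseteq> sets lebesgue"
      by auto
    show "emeasure lebesgue {fst p<..<snd p} \<noteq> \<infinity>" if "p \<in> P" for p
      using le that by (cases p) auto
  qed
  also have "\<dots> \<le> measure lebesgue T"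
  proof (rule measure_mono_fmeasurable[OF _ _ T])
    show "(\<Union>p\<in>P. {fst p<..<snd p}) \<subseteq> T"
      using sub by fastforce
    show "(\<Union>p\<in>P. {fst p<..<snd p}) \<in> sets lebesgue"
      using \<open>finite P\<close> by (intro sets.finite_UN) auto
  qed
  finally show ?thesis .
qed

text \<open>
  At a tag with nonpositive derivative, short intervals around the tag increase \<open>y\<close> by at most
  \<open>e\<close> times their length. The remaining tags lie in a null set, which has an open cover of measure so
  small that absolute continuity bounds the total variation over intervals inside the cover.
  A tagged division that is fine for a gauge encoding both requirements exists by Cousin's lemma, and
  telescoping over it adds up the two bounds.
\<close>

lemma abs_continuous_on_imp_nonincreasing:
  fixes y :: "real \<Rightarrow> real"
  assumes "a \<le> b" and ac: "abs_continuous_on a b y"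
    and deriv: "AE t in lebesgue. t \<in> {a..b} \<longrightarrow>
                  (\<exists>d\<le>0. (y has_real_derivative d) (at t within {a..b}))"
  shows "y b \<le> y a"
proof -
  have step: "y b - y a \<le> e * (b - a) + e" if "e > 0" for e
  proof -
    obtain \<delta> where "\<delta> > 0" and \<delta>: "\<And>P. finite P \<Longrightarrow> \<forall>(u, v)\<in>P. a \<le> u \<and> u \<le> v \<and> v \<le> b \<Longrightarrow>
        pairwise (\<lambda>p q. {fst p<..<snd p} \<inter> {fst q<..<snd q} = {}) P \<Longrightarrow>
        (\<Sum>(u, v)\<in>P. v - u) < \<delta> \<Longrightarrow> (\<Sum>(u, v)\<in>P. norm (y v - y u)) < e"
      using ac \<open>e > 0\<close> unfolding abs_continuous_on_def by meson
    obtain N where N: "N \<in> null_sets lebesgue" and sub: "{t \<in> space lebesgue. \<not> (t \<in> {a..b} \<longrightarrow>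
                  (\<exists>d\<le>0. (y has_real_derivative d) (at t within {a..b})))} \<subseteq> N"
      using deriv unfolding eventually_ae_filter by blast
    then have good: "\<And>t. t \<in> {a..b} \<Longrightarrow> t \<notin> N \<Longrightarrow>
                   \<exists>d\<le>0. (y has_real_derivative d) (at t within {a..b})"
      by auto
    obtain T where "open T" "N \<subseteq> T" and TN: "T - N \<in> lmeasurable"
      and small: "emeasure lebesgue (T - N) < ennreal \<delta>"
      using sets_lebesgue_outer_open[of N \<delta>] null_setsD2[OF N] \<open>\<delta> > 0\<close> by blast
    have T: "T \<in> lmeasurable"
    proof -
      have "T = (T - N) \<union> N" using \<open>N \<subseteq> T\<close> by auto
      then show ?thesis using TN N fmeasurableI_null_sets fmeasurable.Un by metis
    qed
    have "measure lebesgue T = measure lebesgue (T - N)"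
      using N T by (simp add: measure_Diff_null_set fmeasurableD)
    also have "\<dots> < \<delta>"
      using small TN \<open>\<delta> > 0\<close> by (simp add: emeasure_eq_measure2 ennreal_less_iff)
    finally have T_small: "measure lebesgue T < \<delta>" .
    have "\<exists>r>0. (t \<in> N \<longrightarrow> ball t r \<subseteq> T) \<and>
            (t \<in> {a..b} - N \<longrightarrow> (\<forall>u v. a \<le> u \<and> u \<le> t \<and> t \<le> v \<and> v \<le> b \<and> {u..v} \<subseteq> ball t r \<longrightarrow>
               y v - y u \<le> e * (v - u)))" for t
    proof -
      consider "t \<in> N" | "t \<notin> N" "t \<notin> {a..b}" | "t \<notin> N" "t \<in> {a..b}" by blast
      then show ?thesis
      proof cases
        case 1
        then have "t \<in> T" using \<open>N \<subseteq> T\<close> by auto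
        then obtain r where "r > 0" "ball t r \<subseteq> T"
          using \<open>open T\<close> by (auto simp: open_contains_ball)
        then show ?thesis using 1 by blast
      next
        case 2
        then show ?thesis by (intro exI[of _ 1]) auto
      next
        case 3
        then obtain d where "d \<le> 0" and d: "(y has_real_derivative d) (at t within {a..b})"
          using good by blast
        then obtain r where "r > 0"
          and r: "\<And>s. s \<in> {a..b} \<Longrightarrow> norm (s - t) < r \<Longrightarrow>
                    norm (y s - y t - d * (s - t)) \<le> e * norm (s - t)"
          using \<open>e > 0\<close> unfolding has_field_derivative_def has_derivative_within_alt by meson
        have "y v - y u \<le> e * (v - u)"
          if h: "a \<le> u" "u \<le> t" "t \<le> v" "v \<le> b" "{u..v} \<subseteq> ball t r" for u v
        proof -
          have "u \<in> ball t r" "v \<in> ball t r"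
            using h by (auto simp: subset_iff)
          then have "norm (u - t) < r" "norm (v - t) < r"
            by (auto simp: dist_real_def)
          then have "\<bar>y u - y t - d * (u - t)\<bar> \<le> e * (t - u)" "\<bar>y v - y t - d * (v - t)\<bar> \<le> e * (v - t)"
            using r[of u] r[of v] h by auto
          moreover have "d * (u - t) \<ge> 0" "d * (v - t) \<le> 0"
            using \<open>d \<le> 0\<close> h by (auto simp: mult_nonpos_nonpos mult_nonpos_nonneg)
          ultimately show ?thesis by (simp add: algebra_simps)
        qed
        then show ?thesis using \<open>r > 0\<close> 3 by blast
      qed
    qed
    then have "\<exists>r. \<forall>t. r t > 0 \<and> (t \<in> N \<longrightarrow> ball t (r t) \<subseteq> T) \<and>
            (t \<in> {a..b} - N \<longrightarrow> (\<forall>u v. a \<le> u \<and> u \<le> t \<and> t \<le> v \<and> v \<le> b \<and> {u..v} \<subseteq> ball t (r t) \<longrightarrow>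
               y v - y u \<le> e * (v - u)))"
      by (intro choice) simp
    then obtain r where r_pos: "\<forall>t. r t > 0" and rN: "\<And>t. t \<in> N \<Longrightarrow> ball t (r t) \<subseteq> T"
      and rD: "\<And>t u v. t \<in> {a..b} \<Longrightarrow> t \<notin> N \<Longrightarrow> a \<le> u \<Longrightarrow> u \<le> t \<Longrightarrow> t \<le> v \<Longrightarrow> v \<le> b \<Longrightarrow>
               {u..v} \<subseteq> ball t (r t) \<Longrightarrow> y v - y u \<le> e * (v - u)"
      by blast
    then obtain p where p: "p tagged_division_of {a..b}" and fine: "(\<lambda>t. ball t (r t)) fine p"
      using fine_division_exists_real[OF gauge_ball_dependent[OF r_pos]] by blast
    note pD = tagged_division_ofD[OF p]
    have cell: "\<exists>u v. k = {u..v} \<and> Inf k = u \<and> Sup k = v \<and> a \<le> u \<and> u \<le> t \<and> t \<le> v \<and> v \<le> b \<and>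
                  {u..v} \<subseteq> ball t (r t)"
      if tk: "(t, k) \<in> p" for t k
    proof -
      obtain u v where k: "k = {u..v}" using pD(4)[OF tk] by auto
      have "u \<le> t" "t \<le> v" using pD(2)[OF tk] k by auto
      moreover have "{u..v} \<subseteq> {a..b}" using pD(3)[OF tk] k by auto
      moreover have "k \<subseteq> ball t (r t)" using fine tk by (auto simp: fine_def)
      ultimately show ?thesis using k by auto
    qed
    \<comment> \<open>The intervals tagged in the null set, given by their endpoints.\<close>
    define pN where "pN = {tk \<in> p. fst tk \<in> N}"
    define Q where "Q = (\<lambda>(t, k). (Inf k, Sup k)) ` pN"
    have fin: "finite p" "finite pN" "finite Q"
      using pD(1) by (auto simp: pN_def Q_def)
    have Q: "\<exists>t. (t, {u..v}) \<in> pN \<and> a \<le> u \<and> u \<le> t \<and> t \<le> v \<and> v \<le> b \<and> {u..v} \<subseteq> T"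
      if uv: "(u, v) \<in> Q" for u v
    proof -
      obtain t k where tk: "(t, k) \<in> pN" "u = Inf k" "v = Sup k" 
        using uv unfolding Q_def by auto
      then have "(t, k) \<in> p" "t \<in> N" by (auto simp: pN_def)
      then show ?thesis using cell[of t k] rN[of t] tk by auto
    qed
    have disj: "pairwise (\<lambda>p q. {fst p<..<snd p} \<inter> {fst q<..<snd q} = {}) Q"
    proof (rule pairwiseI)
      fix x x' assume x: "x \<in> Q" "x' \<in> Q" "x \<noteq> x'"
      obtain u v u' v' where [simp]: "x = (u, v)" "x' = (u', v')" by (cases x, cases x')
      obtain t t' where t: "(t, {u..v}) \<in> p" "(t', {u'..v'}) \<in> p" "u \<le> v" "u' \<le> v'"
        using Q[of u v] Q[of u' v'] x unfolding pN_def by force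
      have "{u..v} \<noteq> {u'..v'}" using t x by (auto simp: Icc_eq_Icc)
      then show "{fst x<..<snd x} \<inter> {fst x'<..<snd x'} = {}"
        using pD(5)[OF t(1,2)] by (simp add: interior_atLeastAtMost_real)
    qed
    have "(\<Sum>(u, v)\<in>Q. v - u) \<le> measure lebesgue T"
      by (rule sum_lengths_le_measure[OF fin(3) _ _ disj T]) (use Q in force)+
    then have "(\<Sum>(u, v)\<in>Q. norm (y v - y u)) < e"
      using T_small by (intro \<delta>[OF fin(3) _ disj]) (use Q in force)+
    moreover have "(\<Sum>(u, v)\<in>Q. norm (y v - y u)) = (\<Sum>(t, k)\<in>pN. norm (y (Sup k) - y (Inf k)))"
      unfolding Q_def
    proof (subst sum.reindex_nontrivial[OF fin(2)])
      fix x x' assume x: "x \<in> pN" "x' \<in> pN" "x \<noteq> x'"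
        and eq: "(case x of (t, k) \<Rightarrow> (Inf k, Sup k)) = (case x' of (t, k) \<Rightarrow> (Inf k, Sup k))"
      obtain t k t' k' where [simp]: "x = (t, k)" "x' = (t', k')" by (cases x, cases x')
      have mem: "(t, k) \<in> p" "(t', k') \<in> p" using x by (auto simp: pN_def)
      obtain u v where k: "k = {u..v}" "k' = {u..v}" "Inf k = u" "Sup k = v" "u \<le> v"
        using cell[OF mem(1)] cell[OF mem(2)] eq by auto
      \<comment> \<open>Different tags can share an interval only if it is degenerate; it then contributes zero.\<close>
      have "interior k \<inter> interior k' = {}"
        using pD(5)[OF mem] x by auto
      then have "u = v" using k by (auto simp: interior_atLeastAtMost_real)
      then show "(case case x of (t, k) \<Rightarrow> (Inf k, Sup k) of (u, v) \<Rightarrow> norm (y v - y u)) = 0"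
        using k by auto
    qed (auto intro!: sum.cong simp: case_prod_unfold)
    ultimately have bad: "(\<Sum>(t, k)\<in>pN. norm (y (Sup k) - y (Inf k))) < e" by simp
    have "y b - y a = (\<Sum>(t, k)\<in>p. y (Sup k) - y (Inf k))"
      using additive_tagged_division_1[OF \<open>a \<le> b\<close> p, of y] by simp
    also have "\<dots> \<le> (\<Sum>(t, k)\<in>p. (e * Sup k - e * Inf k) +
                        (if t \<in> N then norm (y (Sup k) - y (Inf k)) else 0))"
    proof (rule sum_mono, clarify)
      fix t k assume tk: "(t, k) \<in> p"
      then obtain u v where k: "Inf k = u" "Sup k = v" "a \<le> u" "u \<le> t" "t \<le> v" "v \<le> b"
        "{u..v} \<subseteq> ball t (r t)" using cell by meson
      show "y (Sup k) - y (Inf k) \<le> (e * Sup k - e * Inf k) +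
              (if t \<in> N then norm (y (Sup k) - y (Inf k)) else 0)"
      proof (cases "t \<in> N")
        case True
        have "e * u \<le> e * v" using k \<open>e > 0\<close> by simp
        then show ?thesis using True k by simp
      next
        case False
        then show ?thesis using rD[of t u v] k by (simp add: algebra_simps)
      qed
    qed
    also have "\<dots> = (\<Sum>(t, k)\<in>p. e * Sup k - e * Inf k) +
                    (\<Sum>(t, k)\<in>p. if t \<in> N then norm (y (Sup k) - y (Inf k)) else 0)"
      by (simp add: sum.distrib case_prod_unfold)
    also have "(\<Sum>(t, k)\<in>p. e * Sup k - e * Inf k) = e * b - e * a"
      using additive_tagged_division_1[OF \<open>a \<le> b\<close> p, of "\<lambda>t. e * t"] by simp
    also have "(\<Sum>(t, k)\<in>p. if t \<in> N then norm (y (Sup k) - y (Inf k)) else 0) =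
               (\<Sum>(t, k)\<in>pN. norm (y (Sup k) - y (Inf k)))"
      unfolding pN_def using fin(1)
      by (simp add: sum.inter_filter case_prod_unfold cong: if_cong)
    finally show ?thesis using bad by (simp add: algebra_simps)
  qed
  show ?thesis
  proof (rule ccontr)
    assume "\<not> ?thesis"
    then have pos: "y b - y a > 0" by simp
    define e where "e = (y b - y a) / 2 / (b - a + 1)"
    have "e > 0" using pos \<open>a \<le> b\<close> by (simp add: e_def)
    have "e * (b - a) + e = e * (b - a + 1)" by (simp add: algebra_simps)
    also have "\<dots> = (y b - y a) / 2"
      unfolding e_def using \<open>a \<le> b\<close> by (intro nonzero_eq_divide_eq[THEN iffD1]) auto
    finally have "e * (b - a) + e = (y b - y a) / 2" .
    then show False using step[OF \<open>e > 0\<close>] pos by simp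
  qed
qed

lemma abs_continuous_on_imp_continuous_on:
  assumes "abs_continuous_on a b x"
  shows "continuous_on {a..b} x"
  unfolding continuous_on_iff
proof safe
  fix t e :: real assume t: "t \<in> {a..b}" and "e > 0"
  then obtain \<delta> where "\<delta> > 0" and \<delta>: "\<And>P. finite P \<Longrightarrow> \<forall>(u, v)\<in>P. a \<le> u \<and> u \<le> v \<and> v \<le> b \<Longrightarrow>
        pairwise (\<lambda>p q. {fst p<..<snd p} \<inter> {fst q<..<snd q} = {}) P \<Longrightarrow>
        (\<Sum>(u, v)\<in>P. v - u) < \<delta> \<Longrightarrow> (\<Sum>(u, v)\<in>P. norm (x v - x u)) < e"
    using assms unfolding abs_continuous_on_def by meson
  have close: "norm (x v - x u) < e" if "a \<le> u" "u \<le> v" "v \<le> b" "v - u < \<delta>" for u v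
    using \<delta>[of "{(u, v)}"] that by auto
  have "dist (x s) (x t) < e" if "s \<in> {a..b}" "dist s t < \<delta>" for s
    using close[of s t] close[of t s] that t
    by (cases "s \<le> t") (auto simp: dist_norm norm_minus_commute)
  then show "\<exists>d>0. \<forall>s\<in>{a..b}. dist s t < d \<longrightarrow> dist (x s) (x t) < e"
    using \<open>\<delta> > 0\<close> by blast
qed

text \<open>
  Both factors are bounded on the compact interval, so an increment of the product is dominated by a
  combination of the increments of the factors. It serves for the inner product of a
  trajectory with itself and for an exponential weight times a scalar function.
\<close>

lemma (in bounded_bilinear) abs_continuous_on_prod:
  assumes f: "abs_continuous_on a b f" and g: "abs_continuous_on a b g"
  shows "abs_continuous_on a b (\<lambda>t. prod (f t) (g t))"
  unfolding abs_continuous_on_def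
proof (intro allI impI)
  fix e :: real assume "e > 0"
  have bnd: "\<exists>B>0. \<forall>t\<in>{a..b}. norm (h t) \<le> B" if "abs_continuous_on a b h"
    for h :: "real \<Rightarrow> 'z::real_normed_vector"
    using compact_continuous_image[OF abs_continuous_on_imp_continuous_on[OF that] compact_Icc]
    by (auto dest!: compact_imp_bounded simp: bounded_pos)
  obtain A where A: "A > 0" "\<And>t. t \<in> {a..b} \<Longrightarrow> norm (f t) \<le> A" using bnd[OF f] by blast
  obtain B where B: "B > 0" "\<And>t. t \<in> {a..b} \<Longrightarrow> norm (g t) \<le> B" using bnd[OF g] by blast
  obtain K where "K > 0" and K: "\<And>u v. norm (prod u v) \<le> norm u * norm v * K"
    using pos_bounded by blast
  define e' where "e' = e / (K * (A + B))"
  have "e' > 0" using \<open>e > 0\<close> A B \<open>K > 0\<close> by (simp add: e'_def)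
  let ?adm = "\<lambda>P d. finite P \<and> (\<forall>(u, v)\<in>P. a \<le> u \<and> u \<le> v \<and> v \<le> b) \<and>
        pairwise (\<lambda>p q. {fst p<..<snd p} \<inter> {fst q<..<snd q} = {}) P \<and>
        (\<Sum>(u, v)\<in>P. v - u) < d"
  obtain d where "d > 0" and d: "\<And>P. ?adm P d \<Longrightarrow> (\<Sum>(u, v)\<in>P. norm (f v - f u)) < e'"
    using f \<open>e' > 0\<close> unfolding abs_continuous_on_def by meson
  obtain d' where "d' > 0" and d': "\<And>P. ?adm P d' \<Longrightarrow> (\<Sum>(u, v)\<in>P. norm (g v - g u)) < e'"
    using g \<open>e' > 0\<close> unfolding abs_continuous_on_def by meson
  show "\<exists>\<delta>>0. \<forall>P. ?adm P \<delta> \<longrightarrow>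
          (\<Sum>(u, v)\<in>P. norm (prod (f v) (g v) - prod (f u) (g u))) < e"
  proof (intro exI[of _ "min d d'"] conjI allI impI)
    show "min d d' > 0" using \<open>d > 0\<close> \<open>d' > 0\<close> by simp
    fix P assume P: "?adm P (min d d')"
    have "(\<Sum>(u, v)\<in>P. norm (prod (f v) (g v) - prod (f u) (g u)))
        \<le> (\<Sum>(u, v)\<in>P. K * A * norm (g v - g u) + K * B * norm (f v - f u))"
    proof (rule sum_mono, clarify)
      fix u v assume "(u, v) \<in> P"
      then have uv: "u \<in> {a..b}" "v \<in> {a..b}" using P by fastforce+
      have "prod (f v) (g v) - prod (f u) (g u) = prod (f v) (g v - g u) + prod (f v - f u) (g u)"
        by (simp add: diff_left diff_right)
      then have "norm (prod (f v) (g v) - prod (f u) (g u))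
          \<le> norm (f v) * norm (g v - g u) * K + norm (f v - f u) * norm (g u) * K"
        by (metis K norm_triangle_mono)
      also have "\<dots> \<le> A * norm (g v - g u) * K + norm (f v - f u) * B * K"
        using A(2)[OF uv(2)] B(2)[OF uv(1)] \<open>K > 0\<close>
        by (intro add_mono mult_right_mono mult_left_mono) auto
      finally show "norm (prod (f v) (g v) - prod (f u) (g u))
          \<le> K * A * norm (g v - g u) + K * B * norm (f v - f u)"
        by (simp add: mult_ac)
    qed
    also have "\<dots> = K * A * (\<Sum>(u, v)\<in>P. norm (g v - g u)) + K * B * (\<Sum>(u, v)\<in>P. norm (f v - f u))"
      by (simp add: sum.distrib sum_distrib_left case_prod_unfold)
    also have "\<dots> < K * A * e' + K * B * e'"
      using d[of P] d'[of P] P A B \<open>K > 0\<close>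
      by (intro add_strict_mono mult_strict_left_mono) auto
    also have "\<dots> = K * (A + B) * e'" by (simp add: algebra_simps)
    also have "\<dots> = e" using A(1) B(1) \<open>K > 0\<close> by (simp add: e'_def)
    finally show "(\<Sum>(u, v)\<in>P. norm (prod (f v) (g v) - prod (f u) (g u))) < e" .
  qed
qed

lemma lipschitz_on_imp_abs_continuous_on:
  assumes "L-lipschitz_on {a..b} f"
  shows "abs_continuous_on a b f"
  unfolding abs_continuous_on_def
proof (intro allI impI)
  fix e :: real assume "e > 0"
  have "L \<ge> 0" using assms lipschitz_on_nonneg by blast
  show "\<exists>\<delta>>0. \<forall>P. finite P \<and> (\<forall>(u, v)\<in>P. a \<le> u \<and> u \<le> v \<and> v \<le> b) \<and>
        pairwise (\<lambda>p q. {fst p<..<snd p} \<inter> {fst q<..<snd q} = {}) P \<and>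
        (\<Sum>(u, v)\<in>P. v - u) < \<delta> \<longrightarrow> (\<Sum>(u, v)\<in>P. norm (f v - f u)) < e"
  proof (intro exI[of _ "e / (L + 1)"] conjI allI impI)
    show "e / (L + 1) > 0" using \<open>e > 0\<close> \<open>L \<ge> 0\<close> by simp
    fix P :: "(real \<times> real) set"
    assume P: "finite P \<and> (\<forall>(u, v)\<in>P. a \<le> u \<and> u \<le> v \<and> v \<le> b) \<and>
        pairwise (\<lambda>p q. {fst p<..<snd p} \<inter> {fst q<..<snd q} = {}) P \<and>
        (\<Sum>(u, v)\<in>P. v - u) < e / (L + 1)"
    have "(\<Sum>(u, v)\<in>P. norm (f v - f u)) \<le> (\<Sum>(u, v)\<in>P. (L + 1) * (v - u))"
    proof (rule sum_mono, clarify)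
      fix u v assume "(u, v) \<in> P"
      then have uv: "a \<le> u" "u \<le> v" "v \<le> b" using P by fastforce+
      have "norm (f v - f u) \<le> L * (v - u)"
        using lipschitz_onD[OF assms, of v u] uv by (simp add: dist_norm)
      then show "norm (f v - f u) \<le> (L + 1) * (v - u)" using uv by (simp add: algebra_simps)
    qed
    also have "\<dots> = (L + 1) * (\<Sum>(u, v)\<in>P. v - u)"
      by (simp add: sum_distrib_left case_prod_unfold)
    also have "\<dots> < e" using P \<open>L \<ge> 0\<close> by (simp add: field_simps)
    finally show "(\<Sum>(u, v)\<in>P. norm (f v - f u)) < e" .
  qed
qed

text \<open>
  Differentiating the weighted squared distance \<open>exp(2 \<gamma> s) \<parallel>x(s) - x\<^sup>*\<parallel>\<^sup>2\<close> produces
  the factor \<open>2 (\<gamma> \<parallel>x - x\<^sup>*\<parallel>\<^sup>2 + (x - x\<^sup>*) \<bullet> v)\<close>, which dissipativity makes nonpositive.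
  Comparing squares avoids the norm, which is not differentiable where the solution meets \<open>x\<^sup>*\<close>.
\<close>

lemma caratheodory_solution_exponential_decay:
  assumes sol: "caratheodory_solution F x"
    and dissipative: "\<And>z v. v \<in> F z \<Longrightarrow> (z - xs) \<bullet> v \<le> - \<gamma> * (norm (z - xs))\<^sup>2"
    and "\<gamma> > 0" "t \<ge> 0"
  shows "norm (x t - xs) \<le> norm (x 0 - xs) * exp (- \<gamma> * t)"
proof -
  define y where "y s = exp (2 * \<gamma> * s) * ((x s - xs) \<bullet> (x s - xs))" for s
  have "abs_continuous_on 0 t x"
    using sol \<open>t \<ge> 0\<close> by (auto simp: caratheodory_solution_def)
  then have "abs_continuous_on 0 t (\<lambda>s. x s - xs)"
    by (simp add: abs_continuous_on_def)
  then have sq: "abs_continuous_on 0 t (\<lambda>s. (x s - xs) \<bullet> (x s - xs))"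
    by (intro bounded_bilinear.abs_continuous_on_prod[OF bounded_bilinear_inner])
  have "(2 * \<gamma> * exp (2 * \<gamma> * t))-lipschitz_on {0..t} (\<lambda>s. exp (2 * \<gamma> * s))"
  proof (rule lipschitz_onI)
    fix u v assume uv: "u \<in> {0..t}" "v \<in> {0..t}"
    show "dist (exp (2 * \<gamma> * u)) (exp (2 * \<gamma> * v)) \<le> 2 * \<gamma> * exp (2 * \<gamma> * t) * dist u v"
      unfolding dist_norm
      by (rule field_differentiable_bound[of "{0..t}" _ "\<lambda>s. 2 * \<gamma> * exp (2 * \<gamma> * s)"])
         (use uv \<open>\<gamma> > 0\<close> in \<open>auto intro!: derivative_eq_intros\<close>)
  qed (use \<open>\<gamma> > 0\<close> in simp)
  then have "abs_continuous_on 0 t (\<lambda>s. exp (2 * \<gamma> * s))"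
    by (rule lipschitz_on_imp_abs_continuous_on)
  then have ac: "abs_continuous_on 0 t y"
    unfolding y_def using sq
    by (intro bounded_bilinear.abs_continuous_on_prod[OF bounded_bilinear_mult])
  have deriv: "\<exists>d\<le>0. (y has_real_derivative d) (at s within {0..t})"
    if s: "s \<in> {0..t}" and v: "v \<in> F (x s)" and der: "(x has_vector_derivative v) (at s within {0..})"
    for s v
  proof -
    let ?d = "exp (2 * \<gamma> * s) * (2 * \<gamma> * ((x s - xs) \<bullet> (x s - xs)) + 2 * ((x s - xs) \<bullet> v))"
    have "(x has_derivative (\<lambda>h. h *\<^sub>R v)) (at s within {0..t})"
      using has_vector_derivative_within_subset[OF der, of "{0..t}"]
      by (auto simp: has_vector_derivative_def)
    then have "(y has_derivative (\<lambda>h. ?d * h)) (at s within {0..t})"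
      unfolding y_def
      by (auto intro!: derivative_eq_intros simp: algebra_simps inner_commute)
    moreover have "2 * \<gamma> * ((x s - xs) \<bullet> (x s - xs)) + 2 * ((x s - xs) \<bullet> v) \<le> 0"
      using dissipative[OF v] by (simp add: power2_norm_eq_inner)
    then have "?d \<le> 0" by (simp add: mult_nonneg_nonpos)
    ultimately show ?thesis unfolding has_field_derivative_def by blast
  qed
  have "AE s in lebesgue. s \<ge> 0 \<longrightarrow> (\<exists>v\<in>F (x s). (x has_vector_derivative v) (at s within {0..}))"
    using sol by (simp add: caratheodory_solution_def)
  then have "AE s in lebesgue. s \<in> {0..t} \<longrightarrow>
               (\<exists>d\<le>0. (y has_real_derivative d) (at s within {0..t}))"
    by (rule AE_mp) (use deriv in \<open>auto intro!: AE_I2\<close>)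
  then have "y t \<le> y 0"
    by (rule abs_continuous_on_imp_nonincreasing[OF \<open>t \<ge> 0\<close> ac])
  then have "(exp (\<gamma> * t) * norm (x t - xs))\<^sup>2 \<le> (norm (x 0 - xs))\<^sup>2"
    by (simp add: y_def power_mult_distrib power2_norm_eq_inner flip: exp_double)
       (simp add: mult.assoc)
  then have "exp (\<gamma> * t) * norm (x t - xs) \<le> norm (x 0 - xs)"
    by (rule power2_le_imp_le) simp
  then show ?thesis by (simp add: exp_minus field_simps)
qed

section \<open>Subgradients at constrained minimizers\<close>

text \<open>
  The strict hypograph of the constant \<open>f x\<close> over \<open>S\<close> is disjoint from the epigraph of \<open>f\<close> over
  \<open>D\<close>. A separating hyperplane is not vertical because \<open>x\<close> is interior to \<open>D\<close>, so its slope is defined;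
  comparing the whole epigraph with the hypograph
  at \<open>x\<close> makes it a subgradient, comparing the whole hypograph with the epigraph at \<open>x\<close> gives the
  sign condition. For \<open>S = {x}\<close> this is existence of subgradients.
\<close>

lemma constrained_minimum_subgradient:
  fixes f :: "'a::euclidean_space \<Rightarrow> real"
  assumes "open D" and f: "convex_on D f" and "convex S" and "S \<subseteq> D" and "x \<in> S"
    and min: "\<And>y. y \<in> S \<Longrightarrow> f x \<le> f y"
  obtains g where "g \<in> subdifferential D f x" and "\<And>y. y \<in> S \<Longrightarrow> 0 \<le> (y - x) \<bullet> g"
proof -
  have "x \<in> D" using assms by auto
  let ?B = "S \<times> {..<f x}"
  have "convex (epigraph D f)" using f by (simp add: convex_epigraph)
  moreover have "convex ?B" using \<open>convex S\<close> by (intro convex_Times) auto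
  moreover have "(x, f x) \<in> epigraph D f" using \<open>x \<in> D\<close> by (simp add: epigraph_def)
  moreover have "(x, f x - 1) \<in> ?B" using \<open>x \<in> S\<close> by simp
  moreover have "?B \<inter> epigraph D f = {}"
    using min by (force simp: epigraph_def)
  ultimately obtain h c where "h \<noteq> 0" and lo: "\<And>p. p \<in> ?B \<Longrightarrow> h \<bullet> p \<le> c"
    and up: "\<And>p. p \<in> epigraph D f \<Longrightarrow> c \<le> h \<bullet> p"
    using separating_hyperplane_sets[of ?B "epigraph D f"] by blast
  obtain a \<beta> where h: "h = (a, \<beta>)" by (cases h)
  have sep: "a \<bullet> z + \<beta> * s \<le> a \<bullet> y + \<beta> * r" if "z \<in> S" "s < f x" "y \<in> D" "f y \<le> r" for y z r s
  proof -
    have "h \<bullet> (z, s) \<le> c" by (rule lo) (use that in auto)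
    moreover have "c \<le> h \<bullet> (y, r)" by (rule up) (use that in \<open>auto simp: epigraph_def\<close>)
    ultimately show ?thesis by (simp add: h)
  qed
  have "\<beta> \<ge> 0" using sep[of x "f x - 1" x "f x"] \<open>x \<in> S\<close> \<open>x \<in> D\<close> by (simp add: algebra_simps)
  \<comment> \<open>Let the heights in both sets tend to their boundary values.\<close>
  have sep': "a \<bullet> z + \<beta> * f x \<le> a \<bullet> y + \<beta> * f y" if "z \<in> S" "y \<in> D" for y z
  proof (rule field_le_epsilon)
    fix e :: real assume "e > 0"
    have "a \<bullet> z + \<beta> * (f x - e / (\<beta> + 1)) \<le> a \<bullet> y + \<beta> * f y"
      using sep[of z "f x - e / (\<beta> + 1)" y "f y"] that \<open>e > 0\<close> \<open>\<beta> \<ge> 0\<close> by simp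
    moreover have "\<beta> * (e / (\<beta> + 1)) \<le> e"
      using \<open>e > 0\<close> \<open>\<beta> \<ge> 0\<close> by (simp add: field_simps)
    ultimately show "a \<bullet> z + \<beta> * f x \<le> a \<bullet> y + \<beta> * f y + e"
      by (simp add: algebra_simps)
  qed
  have "\<beta> \<noteq> 0"
  proof
    assume "\<beta> = 0"
    then have "a \<noteq> 0" using \<open>h \<noteq> 0\<close> h by (auto simp: zero_prod_def)
    \<comment> \<open>A vertical hyperplane would be crossed by a small step inside the domain against its normal.\<close>
    obtain r where "r > 0" "ball x r \<subseteq> D" using \<open>open D\<close> \<open>x \<in> D\<close> open_contains_ball by blast
    moreover define y where "y = x - (r / (2 * norm a)) *\<^sub>R a"
    ultimately have "y \<in> D"
      using \<open>a \<noteq> 0\<close> by (auto simp: dist_norm subset_iff)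
    then have "a \<bullet> x \<le> a \<bullet> y" using sep'[of x y] \<open>x \<in> S\<close> \<open>\<beta> = 0\<close> by simp
    then have "(r / (2 * norm a)) * (a \<bullet> a) \<le> 0" by (simp add: y_def inner_diff_right)
    moreover have "(r / (2 * norm a)) * (a \<bullet> a) > 0" using \<open>a \<noteq> 0\<close> \<open>r > 0\<close> by simp
    ultimately show False by simp
  qed
  then have "\<beta> > 0" using \<open>\<beta> \<ge> 0\<close> by simp
  show thesis
  proof
    show "- (a /\<^sub>R \<beta>) \<in> subdifferential D f x"
      unfolding subdifferential_def
    proof safe
      fix y assume "y \<in> D"
      then show "f x + (y - x) \<bullet> (- (a /\<^sub>R \<beta>)) \<le> f y"
        using sep'[of x y] \<open>x \<in> S\<close> \<open>\<beta> > 0\<close>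
        by (simp add: field_simps inner_diff_left inner_diff_right inner_commute)
    qed
    show "0 \<le> (y - x) \<bullet> (- (a /\<^sub>R \<beta>))" if "y \<in> S" for y
      using sep'[of y x] that \<open>x \<in> D\<close> \<open>\<beta> > 0\<close>
      by (simp add: divide_simps inner_diff_left inner_diff_right inner_commute)
  qed
qed

lemma subdifferential_nonempty:
  fixes f :: "'a::euclidean_space \<Rightarrow> real"
  assumes "open D" "convex_on D f" "x \<in> D"
  obtains g where "g \<in> subdifferential D f x"
  using constrained_minimum_subgradient[of D f "{x}" x] assms by auto

section \<open>Projection onto the tangent cone\<close>

text \<open>
  This form makes the tangent cone visibly a closed convex cone, which the sequential definition does
  not. For the inclusion from right to left, a limit of scaled feasible directions
  \<open>l\<^sub>k (y\<^sub>k - x)\<close> is reached with step lengths so short that, despite possibly unbounded \<open>l\<^sub>k\<close>,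
  all points stay in \<open>S\<close> by convexity and converge to \<open>x\<close>.
\<close>

lemma tangent_cone_eq_closure_cone_hull:
  assumes "convex S" "x \<in> S"
  shows "tangent_cone S x = closure (cone hull ((\<lambda>y. y - x) ` S))" (is "_ = closure ?C")
proof (intro equalityI subsetI)
  fix v assume "v \<in> tangent_cone S x"
  then obtain s \<tau> where s: "\<And>k. s k \<in> S" and \<tau>: "\<And>k::nat. \<tau> k > (0::real)"
    and v: "(\<lambda>k. (s k - x) /\<^sub>R \<tau> k) \<longlonglongrightarrow> v"
    unfolding tangent_cone_def by blast
  have "(s k - x) /\<^sub>R \<tau> k \<in> ?C" for k
    using s[of k] \<tau>[of k] by (intro mem_cone_hull) (auto simp: less_imp_le)
  then show "v \<in> closure ?C"
    using v unfolding closure_sequential by (intro exI conjI allI)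
next
  fix v assume "v \<in> closure ?C"
  then obtain w where w: "\<And>k. w k \<in> ?C" and v: "w \<longlonglongrightarrow> v"
    unfolding closure_sequential by blast
  have "\<exists>l y. l \<ge> 0 \<and> y \<in> S \<and> w k = l *\<^sub>R (y - x)" for k
    using w[of k] unfolding cone_hull_expl by blast
  then obtain l y where l: "\<And>k. l k \<ge> 0" and y: "\<And>k. y k \<in> S" and w_eq: "\<And>k. w k = l k *\<^sub>R (y k - x)"
    by metis
  \<comment> \<open>The first factor makes the steps vanish, the second keeps the product with the scaling at most 1.\<close>
  define \<tau> where "\<tau> k = inverse (real (Suc k)) / (1 + l k)" for k
  have \<tau>: "\<tau> k > 0" "\<tau> k \<le> inverse (real (Suc k))" "\<tau> k * l k \<le> 1" for k
  proof -
    show "\<tau> k > 0" "\<tau> k \<le> inverse (real (Suc k))"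
      using l[of k] by (auto simp: \<tau>_def divide_simps)
    have "\<tau> k * l k = inverse (real (Suc k)) * (l k / (1 + l k))" by (simp add: \<tau>_def)
    also have "\<dots> \<le> 1 * 1"
      using l[of k] by (intro mult_mono) (auto simp: divide_simps)
    finally show "\<tau> k * l k \<le> 1" by simp
  qed
  have \<tau>0: "\<tau> \<longlonglongrightarrow> 0"
    by (rule tendsto_sandwich[OF _ _ tendsto_const LIMSEQ_inverse_real_of_nat])
       (use \<tau> in \<open>auto simp: less_imp_le\<close>)
  define s where "s k = x + \<tau> k *\<^sub>R w k" for k
  have "s k \<in> S" for k
  proof -
    have "s k = (1 - \<tau> k * l k) *\<^sub>R x + (\<tau> k * l k) *\<^sub>R y k"
      by (simp add: s_def w_eq algebra_simps)
    then show ?thesis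
      using convexD_alt[OF \<open>convex S\<close> \<open>x \<in> S\<close> y[of k], of "\<tau> k * l k"] \<tau>(1,3)[of k] l[of k]
      by (simp add: less_imp_le)
  qed
  moreover have "s \<longlonglongrightarrow> x"
  proof -
    have "s \<longlonglongrightarrow> x + 0 *\<^sub>R v" unfolding s_def by (intro tendsto_intros \<tau>0 v)
    then show ?thesis by simp
  qed
  moreover have "(\<lambda>k. (s k - x) /\<^sub>R \<tau> k) = w"
    using \<tau>(1) by (auto simp: s_def fun_eq_iff less_le)
  ultimately show "v \<in> tangent_cone S x"
    unfolding tangent_cone_def using \<tau>(1) \<tau>0 v by auto
qed

text \<open>
  The residual \<open>- g - v\<close> of the projection \<open>v\<close> has nonpositive inner product with every
  \<open>w - v\<close>, \<open>w\<close> in the tangent cone. In a convex cone \<open>w = v + (y - x)\<close> is an admissible choice.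
\<close>

lemma projected_subgradient_dissipation:
  assumes "convex S" and v: "v \<in> projected_subgradient S D f x" and "y \<in> S"
  obtains g where "x \<in> S" "g \<in> subdifferential D f x" "(y - x) \<bullet> - g \<le> (y - x) \<bullet> v"
proof -
  let ?C = "cone hull ((\<lambda>y. y - x) ` S)" and ?T = "tangent_cone S x"
  have "x \<in> S" using v by (auto simp: projected_subgradient_def split: if_splits)
  then obtain g where g: "g \<in> subdifferential D f x" and v_eq: "v = closest_point ?T (- g)"
    using v by (auto simp: projected_subgradient_def)
  have T: "?T = closure ?C"
    using tangent_cone_eq_closure_cone_hull[OF \<open>convex S\<close> \<open>x \<in> S\<close>] .
  have mem: "y - x \<in> ?T"
    unfolding T using closure_subset hull_subset \<open>y \<in> S\<close> by fastforce
  have "convex ?C"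
    using \<open>convex S\<close> convex_translation_subtract by (intro convex_cone_hull) blast
  then have cvx: "convex ?T" and "closed ?T" by (auto simp: T convex_closure)
  then have "v \<in> ?T" using closest_point_in_set[of ?T "- g"] mem v_eq by auto
  have "v + (y - x) \<in> ?T"
  proof -
    have "(1/2) *\<^sub>R v + (1/2) *\<^sub>R (y - x) \<in> ?T"
      using convexD[OF cvx \<open>v \<in> ?T\<close> mem, of "1/2" "1/2"] by simp
    moreover have "cone ?T" unfolding T by (intro cone_closure cone_cone_hull)
    ultimately have "2 *\<^sub>R ((1/2) *\<^sub>R v + (1/2) *\<^sub>R (y - x)) \<in> ?T"
      using mem_cone[of ?T _ 2] by simp
    then show ?thesis by (simp add: scaleR_add_right del: scaleR_half_double)
  qed
  then have "(- g - v) \<bullet> (v + (y - x) - v) \<le> 0"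
    using closest_point_dot[OF cvx \<open>closed ?T\<close>] v_eq by blast
  then have "(y - x) \<bullet> - g \<le> (y - x) \<bullet> v" by (simp add: inner_diff_left inner_diff_right inner_commute)
  then show thesis using that \<open>x \<in> S\<close> g by blast
qed

text \<open>
  The minimizer has a subgradient \<open>g\<close> for which the tangent cone lies in the half-space
  \<open>g \<bullet> w \<ge> 0\<close>. The point of this half-space closest to \<open>- g\<close> is the origin, which belongs to the cone.
\<close>

lemma constrained_minimum_equilibrium:
  fixes f :: "'a::euclidean_space \<Rightarrow> real"
  assumes "open D" and "convex_on D f" and "convex S" and "S \<subseteq> D" and "x \<in> S"
    and "\<And>y. y \<in> S \<Longrightarrow> f x \<le> f y"
  shows "equilibrium_point (projected_subgradient S D f) x"
proof -
  obtain g where g: "g \<in> subdifferential D f x" and pos: "\<And>y. y \<in> S \<Longrightarrow> 0 \<le> (y - x) \<bullet> g"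
    using constrained_minimum_subgradient[OF assms] by blast
  let ?T = "tangent_cone S x" and ?C = "cone hull ((\<lambda>y. y - x) ` S)"
  have T: "?T = closure ?C"
    using tangent_cone_eq_closure_cone_hull[OF \<open>convex S\<close> \<open>x \<in> S\<close>] .
  have "?C \<subseteq> {w. 0 \<le> g \<bullet> w}"
    using pos by (auto simp: cone_hull_expl inner_commute)
  then have "?T \<subseteq> {w. 0 \<le> g \<bullet> w}"
    unfolding T by (intro closure_minimal) (auto simp: closed_halfspace_ge)
  then have "\<forall>w\<in>?T. dist (- g) 0 \<le> dist (- g) w"
    by (auto simp: dist_norm norm_le inner_diff_left inner_diff_right inner_commute)
  moreover have "convex ?C"
    using \<open>convex S\<close> convex_translation_subtract by (intro convex_cone_hull) blast
  moreover have "0 \<in> ?T"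
    unfolding T using \<open>x \<in> S\<close> cone_hull_contains_0 closure_subset by blast
  ultimately have "0 = closest_point ?T (- g)"
    by (intro closest_point_unique) (auto simp: T convex_closure)
  then show ?thesis
    using g \<open>x \<in> S\<close> by (force simp: equilibrium_point_def projected_subgradient_def)
qed

section \<open>Strong convexity from strong monotonicity\<close>

text \<open>
  Between \<open>m\<close> and \<open>z\<close>, take one further subgradient at their midpoint \<open>p\<close> and chain the subgradient
  inequalities from \<open>m\<close> to \<open>p\<close> and from \<open>p\<close> to \<open>z\<close>. Strong monotonicity between \<open>m\<close> and \<open>p\<close> gains
  \<open>\<beta>/4 \<parallel>z - m\<parallel>\<^sup>2\<close> over the subgradient inequality at \<open>m\<close>. Applied to \<open>z = x\<close> and
  \<open>z = y\<close> with the same subgradient at \<open>m\<close>, the linear terms cancel. A finer subdivision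
  would improve the constant to the optimal \<open>\<beta>/4\<close>, but any positive constant gives exponential
  convergence.
\<close>

lemma strongly_monotone_imp_midpoint_strongly_convex:
  fixes f :: "'a::euclidean_space \<Rightarrow> real"
  assumes "open D" "convex_on D f" "convex S" "S \<subseteq> D" "x \<in> S" "y \<in> S"
    and mono: "\<And>u v g h. u \<in> S \<Longrightarrow> v \<in> S \<Longrightarrow> g \<in> subdifferential D f u \<Longrightarrow>
                 h \<in> subdifferential D f v \<Longrightarrow> (u - v) \<bullet> (g - h) \<ge> \<beta> * (norm (u - v))\<^sup>2"
  shows "2 * f (midpoint x y) + \<beta> / 8 * (norm (x - y))\<^sup>2 \<le> f x + f y"
proof -
  let ?m = "midpoint x y"
  have mid: "midpoint u v \<in> S" if "u \<in> S" "v \<in> S" for u v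
    using \<open>convex S\<close> that midpoint_in_closed_segment closed_segment_subset by blast
  have half: "f ?m + (z - ?m) \<bullet> g + \<beta> / 4 * (norm (z - ?m))\<^sup>2 \<le> f z"
    if "z \<in> S" and g: "g \<in> subdifferential D f ?m" for z g
  proof -
    let ?p = "midpoint ?m z"
    have p: "?p \<in> S" "?m \<in> S" using mid assms that by auto
    then obtain h where h: "h \<in> subdifferential D f ?p"
      using subdifferential_nonempty[of D f ?p] assms by blast
    have diffs: "z - ?p = (1/2) *\<^sub>R (z - ?m)" "?p - ?m = (1/2) *\<^sub>R (z - ?m)"
      by (simp_all add: midpoint_def[of ?m z] algebra_simps flip: scaleR_2)
    have "?p \<in> D" "z \<in> D" using p that \<open>S \<subseteq> D\<close> by auto
    then have "f ?p + (z - ?p) \<bullet> h \<le> f z" "f ?m + (?p - ?m) \<bullet> g \<le> f ?p"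
      using h g by (auto simp: subdifferential_def)
    moreover have "\<beta> * (norm (?p - ?m))\<^sup>2 \<le> (?p - ?m) \<bullet> (h - g)"
      using mono[OF p(1) p(2) h g] .
    ultimately have "f ?p + (z - ?m) \<bullet> h / 2 \<le> f z" "f ?m + (z - ?m) \<bullet> g / 2 \<le> f ?p"
      "\<beta> / 4 * (norm (z - ?m))\<^sup>2 \<le> (z - ?m) \<bullet> h / 2 - (z - ?m) \<bullet> g / 2"
      unfolding diffs inner_diff_right by (simp_all add: power_divide)
    then show ?thesis by linarith
  qed
  obtain g where g: "g \<in> subdifferential D f ?m"
    using subdifferential_nonempty[of D f ?m] assms mid by blast
  have diffs: "x - ?m = (1/2) *\<^sub>R (x - y)" "y - ?m = - ((1/2) *\<^sub>R (x - y))"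
    by (simp_all add: midpoint_def algebra_simps flip: scaleR_2)
  have "f ?m + (x - y) \<bullet> g / 2 + \<beta> / 16 * (norm (x - y))\<^sup>2 \<le> f x"
    "f ?m - (x - y) \<bullet> g / 2 + \<beta> / 16 * (norm (x - y))\<^sup>2 \<le> f y"
    using half[OF \<open>x \<in> S\<close> g] half[OF \<open>y \<in> S\<close> g]
    unfolding diffs norm_minus_cancel by (simp_all add: power_divide)
  then show ?thesis by simp
qed

text \<open>
  The subgradient inequality from \<open>x\<close> to the midpoint, doubled, bounds the midpoint value in the
  strong convexity inequality from below.
\<close>

lemma midpoint_strongly_convex_subgradient:
  fixes f :: "'a::euclidean_space \<Rightarrow> real"
  assumes "midpoint x y \<in> D" "g \<in> subdifferential D f x"
    and "2 * f (midpoint x y) + \<gamma> * (norm (x - y))\<^sup>2 \<le> f x + f y"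
  shows "f x + (y - x) \<bullet> g + \<gamma> * (norm (x - y))\<^sup>2 \<le> f y"
proof -
  have "midpoint x y - x = (1/2) *\<^sub>R (y - x)"
    by (simp add: midpoint_def algebra_simps flip: scaleR_2)
  moreover have "f x + (midpoint x y - x) \<bullet> g \<le> f (midpoint x y)"
    using assms by (simp add: subdifferential_def)
  ultimately show ?thesis using assms(3) by simp
qed

text \<open>
  Dissipation towards \<open>xs\<close> bounds \<open>(x - xs) \<bullet> v\<close> by \<open>(xs - x) \<bullet> g\<close> for a subgradient \<open>g\<close> at
  \<open>x\<close>. By strong convexity this is at most \<open>f xs - f x\<close> minus the quadratic gain,
  and \<open>f xs - f x\<close> is nonpositive.
\<close>

lemma strongly_dissipative_at_minimum:
  fixes f :: "'a::euclidean_space \<Rightarrow> real"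
  assumes "convex S" "S \<subseteq> D" "xs \<in> S"
    and min: "\<And>y. y \<in> S \<Longrightarrow> f xs \<le> f y"
    and strong: "\<And>u v. u \<in> S \<Longrightarrow> v \<in> S \<Longrightarrow>
                   2 * f (midpoint u v) + \<gamma> * (norm (u - v))\<^sup>2 \<le> f u + f v"
    and v: "v \<in> projected_subgradient S D f x"
  shows "(x - xs) \<bullet> v \<le> - \<gamma> * (norm (x - xs))\<^sup>2"
proof -
  obtain g where "x \<in> S" and g: "g \<in> subdifferential D f x"
    and le: "(xs - x) \<bullet> - g \<le> (xs - x) \<bullet> v"
    using projected_subgradient_dissipation[OF \<open>convex S\<close> v \<open>xs \<in> S\<close>] .
  have "midpoint x xs \<in> S"
    using \<open>convex S\<close> \<open>x \<in> S\<close> \<open>xs \<in> S\<close> midpoint_in_closed_segment closed_segment_subset by blast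
  then have "f x + (xs - x) \<bullet> g + \<gamma> * (norm (x - xs))\<^sup>2 \<le> f xs"
    using midpoint_strongly_convex_subgradient[OF _ g strong[OF \<open>x \<in> S\<close> \<open>xs \<in> S\<close>]] \<open>S \<subseteq> D\<close>
    by blast
  then show ?thesis using le min[OF \<open>x \<in> S\<close>] by (simp add: inner_diff_left)
qed

section \<open>The penalized objective on product sets\<close>

lemma convex_on_l1_norm: "convex_on UNIV l1_norm"
proof (rule convex_onI)
  fix t :: real and x y :: "real ^ 'm" assume "0 < t" "t < 1"
  have "l1_norm ((1 - t) *\<^sub>R x + t *\<^sub>R y) \<le> (\<Sum>k\<in>UNIV. (1 - t) * \<bar>x $ k\<bar> + t * \<bar>y $ k\<bar>)"
    unfolding l1_norm_def
  proof (rule sum_mono)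
    fix k
    show "\<bar>((1 - t) *\<^sub>R x + t *\<^sub>R y) $ k\<bar> \<le> (1 - t) * \<bar>x $ k\<bar> + t * \<bar>y $ k\<bar>"
      using \<open>0 < t\<close> \<open>t < 1\<close> abs_triangle_ineq[of "(1 - t) * x $ k" "t * y $ k"]
      by (simp add: abs_mult)
  qed
  then show "l1_norm ((1 - t) *\<^sub>R x + t *\<^sub>R y) \<le> (1 - t) * l1_norm x + t * l1_norm y"
    by (simp add: l1_norm_def sum.distrib sum_distrib_left)
qed simp

lemma convex_on_linear_compose:
  assumes f: "convex_on T f" and "linear h" and "convex S" and "h ` S \<subseteq> T"
  shows "convex_on S (\<lambda>x. f (h x))"
proof (rule convex_onI)
  fix t :: real and x y assume "0 < t" "t < 1" "x \<in> S" "y \<in> S"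
  then show "f (h ((1 - t) *\<^sub>R x + t *\<^sub>R y)) \<le> (1 - t) * f (h x) + t * f (h y)"
    using convex_onD[OF f, of t "h x" "h y"] assms(4)
    by (auto simp: linear_add[OF \<open>linear h\<close>] linear_scale[OF \<open>linear h\<close>])
qed fact

lemma convex_on_sum_functions:
  assumes "convex S" and "\<And>i. i \<in> I \<Longrightarrow> convex_on S (f i)"
  shows "convex_on S (\<lambda>x. \<Sum>i\<in>I. f i x)"
  using assms(2)
  by (induction I rule: infinite_finite_induct)
     (auto simp: convex_on_const \<open>convex S\<close> intro: convex_on_add)

lemma convex_product_set:
  assumes "\<And>i. convex (S i)"
  shows "convex (product_set S)"
  using assms by (simp add: convex_def product_set_def)

lemma open_product_set:
  assumes "\<And>i. open (S i)"
  shows "open (product_set S)"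
  using assms by (simp add: product_set_def open_vector_box)

lemma compact_product_set:
  fixes S :: "'n::finite \<Rightarrow> (real ^ 'm) set"
  assumes "\<And>i. compact (S i)"
  shows "compact (product_set S)"
proof -
  have "closed (product_set S)"
    using assms by (simp add: product_set_def closed_vector_box compact_imp_closed)
  obtain B where B: "\<And>i z. z \<in> S i \<Longrightarrow> norm z \<le> B i"
    using compact_imp_bounded[OF assms] unfolding bounded_iff by metis
  have "norm x \<le> (\<Sum>i\<in>UNIV. B i)" if "x \<in> product_set S" for x
  proof -
    have "norm x \<le> (\<Sum>i\<in>UNIV. norm (x $ i))"
      unfolding norm_vec_def by (rule L2_set_le_sum) simp
    also have "\<dots> \<le> (\<Sum>i\<in>UNIV. B i)"
      using that by (intro sum_mono B) (simp add: product_set_def)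
    finally show ?thesis .
  qed
  then have "bounded (product_set S)" unfolding bounded_iff by blast
  with \<open>closed _\<close> show ?thesis by (simp add: compact_eq_bounded_closed)
qed

lemma convex_on_disagreement_penalty:
  assumes "K \<ge> 0"
  shows "convex_on UNIV (\<lambda>x :: real ^ 'm ^ 'n::finite.
           K / 2 * (\<Sum>i\<in>UNIV. \<Sum>j\<in>neighbors E i. l1_norm (x $ i - x $ j)))"
  using assms
  by (intro convex_on_cmul convex_on_sum_functions convex_on_linear_compose[OF convex_on_l1_norm])
     (auto intro!: linearI simp: algebra_simps)

lemma convex_on_penalized_objective:
  fixes E :: "'n::finite rel" and f :: "'n \<Rightarrow> real ^ 'm::finite \<Rightarrow> real"
  assumes "K \<ge> 0" and "\<And>i. convex_on (U i) (f i)"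
  shows "convex_on (product_set U) (penalized_objective E f K)"
proof -
  have cvx: "convex (product_set U)"
    using assms(2) by (intro convex_product_set) (auto dest: convex_on_imp_convex)
  have "convex_on (product_set U) (\<lambda>x. \<Sum>i\<in>UNIV. f i (x $ i))"
    by (intro convex_on_sum_functions cvx convex_on_linear_compose[OF assms(2)])
       (auto intro!: linearI simp: product_set_def)
  moreover have "convex_on (product_set U) (\<lambda>x :: real ^ 'm ^ 'n.
           K / 2 * (\<Sum>i\<in>UNIV. \<Sum>j\<in>neighbors E i. l1_norm (x $ i - x $ j)))"
    by (rule convex_on_subset[OF convex_on_disagreement_penalty[OF assms(1)] _ cvx]) simp
  ultimately show ?thesis
    unfolding penalized_objective_def[abs_def] by (rule convex_on_add)
qed

text \<open>
  The squared norm of a stacked vector is the sum of the squared norms of its blocks, so the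
  inequalities of the agents add up; the penalty, being convex, preserves the result.
\<close>

lemma penalized_objective_midpoint_strongly_convex:
  fixes E :: "'n::finite rel" and f :: "'n \<Rightarrow> real ^ 'm::finite \<Rightarrow> real"
  assumes "K \<ge> 0"
    and f: "\<And>i u v. u \<in> S i \<Longrightarrow> v \<in> S i \<Longrightarrow>
              2 * f i (midpoint u v) + \<gamma> * (norm (u - v))\<^sup>2 \<le> f i u + f i v"
    and x: "x \<in> product_set S" and y: "y \<in> product_set S"
  shows "2 * penalized_objective E f K (midpoint x y) + \<gamma> * (norm (x - y))\<^sup>2
           \<le> penalized_objective E f K x + penalized_objective E f K y"
proof -
  let ?P = "\<lambda>x :: real ^ 'm ^ 'n. K / 2 * (\<Sum>i\<in>UNIV. \<Sum>j\<in>neighbors E i. l1_norm (x $ i - x $ j))"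
  let ?m = "midpoint x y"
  have comp: "?m $ i = midpoint (x $ i) (y $ i)" for i
    by (simp add: midpoint_def)
  have norm_eq: "(norm (x - y))\<^sup>2 = (\<Sum>i\<in>UNIV. (norm (x $ i - y $ i))\<^sup>2)"
    by (simp add: norm_vec_def L2_set_def sum_nonneg)
  have "2 * (\<Sum>i\<in>UNIV. f i (?m $ i)) + \<gamma> * (norm (x - y))\<^sup>2
        = (\<Sum>i\<in>UNIV. 2 * f i (midpoint (x $ i) (y $ i)) + \<gamma> * (norm (x $ i - y $ i))\<^sup>2)"
    by (simp add: norm_eq comp sum.distrib sum_distrib_left)
  also have "\<dots> \<le> (\<Sum>i\<in>UNIV. f i (x $ i) + f i (y $ i))"
    using x y by (intro sum_mono f) (auto simp: product_set_def)
  finally have "2 * (\<Sum>i\<in>UNIV. f i (?m $ i)) + \<gamma> * (norm (x - y))\<^sup>2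
        \<le> (\<Sum>i\<in>UNIV. f i (x $ i)) + (\<Sum>i\<in>UNIV. f i (y $ i))"
    by (simp add: sum.distrib)
  moreover have "2 * ?P ?m \<le> ?P x + ?P y"
  proof -
    have "?m = (1 - 1/2) *\<^sub>R x + (1/2) *\<^sub>R y" by (simp add: midpoint_def algebra_simps)
    then show ?thesis
      using convex_onD[OF convex_on_disagreement_penalty[OF assms(1), of E], of "1/2" x y]
      by simp
  qed
  ultimately show ?thesis unfolding penalized_objective_def by simp
qed

section \<open>Exponential convergence of the penalty dynamics\<close>

theorem theorem2:
  fixes E :: "'n::finite rel"
    and f :: "'n \<Rightarrow> real ^ 'm::finite \<Rightarrow> real"
    and \<Omega> U :: "'n \<Rightarrow> (real ^ 'm) set"
    and K c \<beta> :: real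
  assumes "undirected_graph E"
    and "K \<ge> 0"
    and "\<And>i. open (U i)" and "\<And>i. convex (U i)" and "\<And>i. \<Omega> i \<subseteq> U i"
    and "\<And>i. convex_on (U i) (f i)"
    and "\<And>i. convex (\<Omega> i)" and "\<And>i. compact (\<Omega> i)"
    and "(\<Inter>i. interior (\<Omega> i)) \<noteq> {}"
    and "c > 0"
    and "\<And>i x y. x \<in> \<Omega> i \<Longrightarrow> y \<in> \<Omega> i \<Longrightarrow> \<bar>f i x - f i y\<bar> \<le> c * norm (x - y)"
    and "connected_graph E"
    and "\<beta> > 0"
    and "\<And>i x y g h. x \<in> \<Omega> i \<Longrightarrow> y \<in> \<Omega> i \<Longrightarrow>
           g \<in> subdifferential (U i) (f i) x \<Longrightarrow> h \<in> subdifferential (U i) (f i) y \<Longrightarrow>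
           (x - y) \<bullet> (g - h) \<ge> \<beta> * (norm (x - y))\<^sup>2"
  shows "\<exists>xs. equilibrium_point (penalty_dynamics E f \<Omega> U K) xs \<and>
           (\<forall>z. equilibrium_point (penalty_dynamics E f \<Omega> U K) z \<longrightarrow> z = xs) \<and>
           (\<exists>M>0. \<exists>r>0. \<forall>x.
              caratheodory_solution (penalty_dynamics E f \<Omega> U K) x \<and> x 0 \<in> product_set \<Omega> \<longrightarrow>
              (\<forall>t\<ge>0. norm (x t - xs) \<le> M * norm (x 0 - xs) * exp (- r * t)))"
proof -
  let ?S = "product_set \<Omega>" and ?D = "product_set U" and ?L = "penalized_objective E f K"
  have "convex ?S" "compact ?S" "open ?D"
    using assms by (auto intro: convex_product_set compact_product_set open_product_set)
  have "?S \<subseteq> ?D" using assms(5) by (auto simp: product_set_def)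
  have cvx: "convex_on ?D ?L" using convex_on_penalized_objective assms by blast
  obtain p where "\<And>i. p \<in> interior (\<Omega> i)" using assms(9) by auto
  then have "(\<chi> i. p) \<in> ?S" by (simp add: product_set_def interior_subset[THEN subsetD])
  then have "?S \<noteq> {}" by blast
  moreover have "continuous_on ?S ?L"
    using convex_on_continuous[OF \<open>open ?D\<close> cvx] \<open>?S \<subseteq> ?D\<close> by (rule continuous_on_subset)
  ultimately obtain xs where "xs \<in> ?S" and min: "\<And>y. y \<in> ?S \<Longrightarrow> ?L xs \<le> ?L y"
    using continuous_attains_inf[OF \<open>compact ?S\<close>] by blast
  have "2 * f i (midpoint u v) + \<beta> / 8 * (norm (u - v))\<^sup>2 \<le> f i u + f i v"
    if "u \<in> \<Omega> i" "v \<in> \<Omega> i" for i u v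
    using strongly_monotone_imp_midpoint_strongly_convex[OF assms(3,6,7,5) that assms(14)] .
  then have strong: "2 * ?L (midpoint u v) + \<beta> / 8 * (norm (u - v))\<^sup>2 \<le> ?L u + ?L v"
    if "u \<in> ?S" "v \<in> ?S" for u v
    using penalized_objective_midpoint_strongly_convex[OF \<open>K \<ge> 0\<close> _ that] by blast
  have dissipative: "(x - xs) \<bullet> v \<le> - (\<beta> / 8) * (norm (x - xs))\<^sup>2"
    if "v \<in> penalty_dynamics E f \<Omega> U K x" for x v
    using strongly_dissipative_at_minimum[OF \<open>convex ?S\<close> \<open>?S \<subseteq> ?D\<close> \<open>xs \<in> ?S\<close> min strong]
      that by (simp add: penalty_dynamics_def)
  have eq: "equilibrium_point (penalty_dynamics E f \<Omega> U K) xs"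
    unfolding penalty_dynamics_def
    by (rule constrained_minimum_equilibrium) fact+
  have unique: "z = xs" if "equilibrium_point (penalty_dynamics E f \<Omega> U K) z" for z
    using dissipative[of 0 z] that \<open>\<beta> > 0\<close>
    by (simp add: equilibrium_point_def mult_le_0_iff)
  have decay: "norm (x t - xs) \<le> 1 * norm (x 0 - xs) * exp (- (\<beta> / 8) * t)"
    if "caratheodory_solution (penalty_dynamics E f \<Omega> U K) x" "0 \<le> t" for x t
    using caratheodory_solution_exponential_decay[OF that(1) dissipative _ that(2)] \<open>\<beta> > 0\<close>
    by simp
  show ?thesis
    by (rule exI[of _ xs], intro conjI, rule eq, use unique in blast,
        rule exI[of _ 1], intro conjI zero_less_one, rule exI[of _ "\<beta> / 8"])
       (use decay \<open>\<beta> > 0\<close> in auto)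
qed

end
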